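(* Let $\mathcal G$, $\mathcal T$ be as in the context and let $M_0=\{m\in\mathbb N : \mathcal T^m\text{ is a normal subgroup of }\mathcal G\}$. Then there exists a unique $m_0\in\mathbb N$ such that $M_0=m_0\mathbb N$ (where $m_0\mathbb N=\{m_0n: n\in\mathbb N\}$).
   Context: $\mathbb N=\{1,2,\dots\}$. $E(d)=O(d)\ltimes\mathbb R^d$ is the Euclidean group: elements $(A,b)$ with product $(A_1,b_1)(A_2,b_2)=(A_1A_2,b_1+A_1b_2)$. A translation is an element $(I_d,b)$. A $d$-dimensional space group is a discrete subgroup of $E(d)$ containing $d$ translations with linearly independent translation vectors. For $A_1\in O(d_1)$ and $(A_2,b_2)\in E(d_2)$ put $A_1\oplus(A_2,b_2):=\left(\begin{pmatrix}A_1&0\\ 0&A_2\end{pmatrix},\begin{pmatrix}0\\ b_2\end{pmatrix}\right)\in E(d_1+d_2)$. Setting: $d\in\mathbb N$, $d_1,d_2\in\mathbb N_0$ with $d=d_1+d_2$; $\mathcal S$ is a $d_2$-dimensional space group; $\mathcal G$ is a discrete subgroup of $O(d_1)\oplus\mathcal S=\{A\oplus g: A\in O(d_1),g\in\mathcal S\}$ (understood as $O(d)$ if $d_1=d$ and as $\mathcal S$ if $d_1=0$) such that $\pi(\mathcal G)=\mathcal S$, where $\pi(A\oplus g)=g$. $\mathcal T_{\mathcal S}$ is the group of translations of $\mathcal S$. $\mathcal T\subset\mathcal G$ is a fixed subset such that $\pi|_{\mathcal T}:\mathcal T\to\mathcal T_{\mathcal S}$ is bijective ($\mathcal T$ need not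 be a group). For a subset $X$ of a group and $n\in\mathbb Z$, $X^n:=\{x^n: x\in X\}$ (the set of $n$-th powers of elements). *)

theory Defs
  imports Complex_Main "HOL-Algebra.Coset" "Jordan_Normal_Form.VS_Connect"
begin

text \<open>
  Matrices and vectors with explicit carriers are used because the dimensions may be \<open>0\<close>,
  which finite index types do not allow.  (The library's \<open>orthogonal_mat\<close> only requires
  \<open>A\<^sup>T A\<close> to be diagonal, so it is not the condition below.)
\<close>

definition orth_group :: "nat \<Rightarrow> real mat set" where
  "orth_group d = {A \<in> carrier_mat d d. transpose_mat A * A = 1\<^sub>m d}"

type_synonym isometry = "real mat \<times> real vec"

definition euclidean_group :: "nat \<Rightarrow> isometry monoid" where
  "euclidean_group d =
    \<lparr> carrier = orth_group d \<times> carrier_vec d,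
      mult = (\<lambda>(A\<^sub>1, b\<^sub>1) (A\<^sub>2, b\<^sub>2). (A\<^sub>1 * A\<^sub>2, b\<^sub>1 + A\<^sub>1 *\<^sub>v b\<^sub>2)),
      one = (1\<^sub>m d, 0\<^sub>v d) \<rparr>"

text \<open>
  Discreteness refers to the subspace topology inherited from
  \<open>\<real>\<^bsup>d\<times>d\<^esup> \<times> \<real>\<^bsup>d\<^esup>\<close>: every point is isolated.  The basic neighbourhoods of
  a point are given by the maximum norm of the entries.
\<close>

definition discrete_in_euclidean_group :: "nat \<Rightarrow> isometry set \<Rightarrow> bool" where
  "discrete_in_euclidean_group d X \<longleftrightarrow>
    (\<forall>(A, b) \<in> X. \<exists>\<epsilon>>0. \<forall>(A', b') \<in> X.
       (\<forall>i<d. \<forall>j<d. \<bar>A' $$ (i, j) - A $$ (i, j)\<bar> < \<epsilon>) \<and> (\<forall>i<d. \<bar>b' $ i - b $ i\<bar> < \<epsilon>)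
       \<longrightarrow> (A', b') = (A, b))"

definition discrete_subgroup :: "nat \<Rightarrow> isometry set \<Rightarrow> bool" where
  "discrete_subgroup d H \<longleftrightarrow>
     subgroup H (euclidean_group d) \<and> discrete_in_euclidean_group d H"

definition translations_of :: "nat \<Rightarrow> isometry set \<Rightarrow> isometry set" where
  "translations_of d H = {(A, b) \<in> H. A = 1\<^sub>m d}"

definition space_group :: "nat \<Rightarrow> isometry set \<Rightarrow> bool" where
  "space_group d S \<longleftrightarrow> discrete_subgroup d S \<and>
     (\<exists>B \<subseteq> carrier_vec d. finite B \<and> card B = d \<and>
        \<not> LinearCombinations.module.lin_dep class_ring (module_vec TYPE(real) d) B \<and>
        (\<forall>b\<in>B. (1\<^sub>m d, b) \<in> translations_of d S))"

text \<open>
  For \<open>d\<^sub>1 = 0\<close> the only \<open>A\<^sub>1\<close> is the empty matrix and \<open>A\<^sub>1 \<oplus> g = g\<close>; for \<open>d\<^sub>2 = 0\<close> one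
  gets \<open>(A\<^sub>1, 0)\<close>.  So both degenerate conventions need no special treatment.
\<close>

fun iso_sum :: "real mat \<Rightarrow> isometry \<Rightarrow> isometry" where
  "iso_sum A\<^sub>1 (A\<^sub>2, b\<^sub>2) =
     (four_block_mat A\<^sub>1 (0\<^sub>m (dim_row A\<^sub>1) (dim_col A\<^sub>2)) (0\<^sub>m (dim_row A\<^sub>2) (dim_col A\<^sub>1)) A\<^sub>2,
      0\<^sub>v (dim_row A\<^sub>1) @\<^sub>v b\<^sub>2)"

definition orth_sum :: "nat \<Rightarrow> isometry set \<Rightarrow> isometry set" where
  "orth_sum d\<^sub>1 S = {iso_sum A g | A g. A \<in> orth_group d\<^sub>1 \<and> g \<in> S}"

text \<open>The projection \<open>A \<oplus> g \<mapsto> g\<close>, read off from the last \<open>d\<^sub>2\<close> coordinates.\<close>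

fun iso_proj :: "nat \<Rightarrow> nat \<Rightarrow> isometry \<Rightarrow> isometry" where
  "iso_proj d\<^sub>1 d\<^sub>2 (A, b) =
     (mat d\<^sub>2 d\<^sub>2 (\<lambda>(i, j). A $$ (d\<^sub>1 + i, d\<^sub>1 + j)), vec d\<^sub>2 (\<lambda>i. b $ (d\<^sub>1 + i)))"

text \<open>The set of \<open>n\<close>-th powers of the elements of \<open>X\<close>, not an iterated product set.\<close>

definition powers_of :: "('a, 'b) monoid_scheme \<Rightarrow> 'a set \<Rightarrow> int \<Rightarrow> 'a set" where
  "powers_of G X n = {x [^]\<^bsub>G\<^esub> n | x. x \<in> X}"

lemma iso_proj_iso_sum:
  assumes "A \<in> orth_group d\<^sub>1" and "g \<in> carrier (euclidean_group d\<^sub>2)"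
  shows "iso_proj d\<^sub>1 d\<^sub>2 (iso_sum A g) = g"
proof (cases g)
  case (Pair C c)
  then show ?thesis
    using assms by (auto simp: euclidean_group_def orth_group_def)
qed

lemma iso_sum_zero_left:
  assumes "A \<in> orth_group 0" and "g \<in> carrier (euclidean_group d)"
  shows "iso_sum A g = g"
proof (cases g)
  case (Pair C c)
  then show ?thesis
    using assms by (auto simp: euclidean_group_def orth_group_def)
qed

lemma iso_sum_closed:
  assumes "A \<in> orth_group d\<^sub>1" and "g \<in> carrier (euclidean_group d\<^sub>2)"
  shows "iso_sum A g \<in> carrier (euclidean_group (d\<^sub>1 + d\<^sub>2))"
proof (cases g)
  case (Pair C c)
  have A: "A \<in> carrier_mat d\<^sub>1 d\<^sub>1" "transpose_mat A * A = 1\<^sub>m d\<^sub>1"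
    and C: "C \<in> carrier_mat d\<^sub>2 d\<^sub>2" "transpose_mat C * C = 1\<^sub>m d\<^sub>2" "c \<in> carrier_vec d\<^sub>2"
    using assms Pair by (auto simp: euclidean_group_def orth_group_def)
  have [simp]: "dim_row A = d\<^sub>1" "dim_col A = d\<^sub>1" "dim_row C = d\<^sub>2" "dim_col C = d\<^sub>2"
    using A C by auto
  define F where "F = four_block_mat A (0\<^sub>m d\<^sub>1 d\<^sub>2) (0\<^sub>m d\<^sub>2 d\<^sub>1) C"
  have "transpose_mat F
      = four_block_mat (transpose_mat A) (0\<^sub>m d\<^sub>1 d\<^sub>2) (0\<^sub>m d\<^sub>2 d\<^sub>1) (transpose_mat C)"
    unfolding F_def using transpose_four_block_mat[OF A(1) _ _ C(1)]
    by (simp add: zero_transpose_mat)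
  then have "transpose_mat F * F
      = four_block_mat (1\<^sub>m d\<^sub>1) (0\<^sub>m d\<^sub>1 d\<^sub>2) (0\<^sub>m d\<^sub>2 d\<^sub>1) (1\<^sub>m d\<^sub>2)"
    unfolding F_def using A C
    by (simp add: mult_four_block_mat[of _ d\<^sub>1 d\<^sub>1 _ d\<^sub>2 _ d\<^sub>2 _ _ d\<^sub>1 _ d\<^sub>2])
  then have "transpose_mat F * F = 1\<^sub>m (d\<^sub>1 + d\<^sub>2)"
    by simp
  moreover have "F \<in> carrier_mat (d\<^sub>1 + d\<^sub>2) (d\<^sub>1 + d\<^sub>2)"
    unfolding F_def using A C by auto
  ultimately show ?thesis
    using Pair C(3) by (auto simp: euclidean_group_def orth_group_def F_def)
qed

lemma group_euclidean_group: "group (euclidean_group d)"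
proof (rule groupI)
  fix x y assume "x \<in> carrier (euclidean_group d)" "y \<in> carrier (euclidean_group d)"
  then obtain A b C c where xy: "x = (A, b)" "y = (C, c)"
    and A: "A \<in> carrier_mat d d" "transpose_mat A * A = 1\<^sub>m d" "b \<in> carrier_vec d"
    and C: "C \<in> carrier_mat d d" "transpose_mat C * C = 1\<^sub>m d" "c \<in> carrier_vec d"
    by (auto simp: euclidean_group_def orth_group_def)
  have "transpose_mat (A * C) * (A * C) = transpose_mat C * ((transpose_mat A * A) * C)"
    using A(1) C(1)
    by (simp add: transpose_mult[of A d d C d] assoc_mult_mat[of _ d d _ d _ d])
  then have "transpose_mat (A * C) * (A * C) = 1\<^sub>m d"
    using A C by simp
  then show "x \<otimes>\<^bsub>euclidean_group d\<^esub> y \<in> carrier (euclidean_group d)"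
    using A C by (auto simp: xy euclidean_group_def orth_group_def)
next
  fix x y z
  assume "x \<in> carrier (euclidean_group d)" "y \<in> carrier (euclidean_group d)"
    "z \<in> carrier (euclidean_group d)"
  then show "x \<otimes>\<^bsub>euclidean_group d\<^esub> y \<otimes>\<^bsub>euclidean_group d\<^esub> z
      = x \<otimes>\<^bsub>euclidean_group d\<^esub> (y \<otimes>\<^bsub>euclidean_group d\<^esub> z)"
    by (auto simp: euclidean_group_def orth_group_def mult_add_distrib_mat_vec[of _ d d]
        assoc_mult_mat[of _ d d _ d _ d] assoc_mult_mat_vec[of _ d d _ d]
        intro!: assoc_add_vec[of _ d])
next
  fix x assume "x \<in> carrier (euclidean_group d)"
  then obtain A b where x: "x = (A, b)"
    and A: "A \<in> carrier_mat d d" "transpose_mat A * A = 1\<^sub>m d" "b \<in> carrier_vec d"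
    by (auto simp: euclidean_group_def orth_group_def)
  have "A * transpose_mat A = 1\<^sub>m d"
    using mat_mult_left_right_inverse[OF _ A(1,2)] A(1) by simp
  moreover have "- (transpose_mat A *\<^sub>v b) + transpose_mat A *\<^sub>v b = 0\<^sub>v d"
    using A by (intro uminus_l_inv_vec) auto
  ultimately show "\<exists>y \<in> carrier (euclidean_group d).
      y \<otimes>\<^bsub>euclidean_group d\<^esub> x = \<one>\<^bsub>euclidean_group d\<^esub>"
    using A x
    by (intro bexI[of _ "(transpose_mat A, - (transpose_mat A *\<^sub>v b))"])
      (auto simp: euclidean_group_def orth_group_def)
qed (auto simp: euclidean_group_def orth_group_def)

end

theory Submission
  imports Defs "HOL-Algebra.SndIsomorphismGrp" "HOL-Algebra.Multiplicative_Group"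
begin

text \<open>
  The kernel \<open>N\<close> of the projection is finite, because it is a discrete subset of the bounded
  set \<open>O(d\<^sub>1)\<close>, and the translations of \<open>\<S>\<close> form a torsion-free abelian group \<open>A\<close>.
  Let \<open>K\<close> be the preimage of \<open>A\<close> in \<open>\<G>\<close>. With \<open>e = |N|\<close>, the power \<open>x\<^bsup>e!\<^esup>\<close> centralizes \<open>N\<close>, so
  \<open>x\<^bsup>e! e\<^esup>\<close> is central in \<open>K\<close>, since commutators in \<open>K\<close> lie in \<open>N\<close>. It follows that
  \<open>x \<mapsto> x\<^bsup>e! e e\<^esup>\<close> is a homomorphism on \<open>K\<close> that kills \<open>N\<close>, and its image \<open>\<T>\<^bsup>e! e e\<^esup>\<close> is a
  normal subgroup of \<open>\<G>\<close>.

  Since \<open>A\<close> is torsion-free, the projection is injective on \<open>\<T>\<^bsup>m\<^esup>\<close> for \<open>m > 0\<close>. Hence a subgroup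
  \<open>\<T>\<^bsup>m\<^esup>\<close> is abelian, and \<open>\<T>\<^bsup>mn\<^esup>\<close> is its image under the \<open>n\<close>-th power map. If \<open>\<T>\<^bsup>m\<^esup>\<close> and \<open>\<T>\<^bsup>n\<^esup>\<close>
  are both normal subgroups, then the projection is still injective on the normal subgroup
  \<open>\<T>\<^bsup>m\<^esup>\<T>\<^bsup>n\<^esup>\<close>, which contains \<open>\<T>\<^bsup>gcd(m,n)\<^esup>\<close> and has the same projection, so the two
  sets agree. So \<open>M\<^sub>0\<close> is nonempty and closed under multiples and greatest common divisors.
\<close>

section \<open>Sets of positive integers closed under multiples and gcd\<close>

text \<open>The least element \<open>l\<close> generates: for \<open>m\<close> in \<open>M\<close>
  the gcd of \<open>l\<close> and \<open>m\<close> is again in \<open>M\<close> and at most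
  \<open>l\<close>, hence equals \<open>l\<close>, so \<open>l\<close> divides \<open>m\<close>. Any
  other generator \<open>k\<close> lies in \<open>M\<close> and divides \<open>l\<close>, so the two
  divide each other.\<close>

lemma ex1_generator_of_multiples:
  fixes M :: "nat set"
  assumes "M \<noteq> {}"
    and pos: "\<And>m. m \<in> M \<Longrightarrow> 1 \<le> m"
    and mult: "\<And>m n. m \<in> M \<Longrightarrow> 1 \<le> n \<Longrightarrow> m * n \<in> M"
    and gcd: "\<And>m n. m \<in> M \<Longrightarrow> n \<in> M \<Longrightarrow> gcd m n \<in> M"
  shows "\<exists>!m\<^sub>0. 1 \<le> m\<^sub>0 \<and> M = {m\<^sub>0 * n | n. 1 \<le> n}"
proof -
  define l where "l = (LEAST m. m \<in> M)"
  have l: "l \<in> M"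
    unfolding l_def using assms(1) by (metis LeastI ex_in_conv)
  have dvd: "l dvd m" if "m \<in> M" for m
  proof -
    have "l \<le> gcd l m"
      using gcd[OF l that] by (simp add: l_def Least_le)
    then have "gcd l m = l"
      using pos[OF l] by (intro le_antisym gcd_le1_nat) auto
    then show ?thesis
      using gcd_dvd2[of l m] by simp
  qed
  have "M = {l * n | n. 1 \<le> n}"
  proof (intro equalityI subsetI)
    fix m assume "m \<in> M"
    then obtain n where "m = l * n" "m \<ge> 1"
      using dvd pos by blast
    then show "m \<in> {l * n | n. 1 \<le> n}"
      by (intro CollectI exI[of _ n]) (cases n, simp_all)
  qed (use l mult in auto)
  moreover have "k = l" if "1 \<le> k" "M = {k * n | n. 1 \<le> n}" for k
  proof -
    have "k = k * 1" by simp
    then have "k \<in> M"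
      using that by blast
    moreover have "k dvd l"
      using l that by auto
    ultimately show ?thesis
      using dvd by (simp add: dvd_antisym)
  qed
  ultimately show ?thesis
    using pos[OF l] by blast
qed

section \<open>Powers in groups: common roots, commutators, power maps\<close>

text \<open>Torsion-freeness allows the common factor of \<open>m\<close> and \<open>n\<close> to be
  cancelled from the relation; for the resulting coprime exponents Bezout's identity produces the
  root.\<close>

lemma (in comm_group) common_root_of_equal_powers:
  fixes m n :: nat
  assumes torsion_free: "\<And>c k. c \<in> carrier G \<Longrightarrow> 0 < k \<Longrightarrow> c [^] (k::nat) = \<one> \<Longrightarrow> c = \<one>"
    and "0 < m" and ab: "a \<in> carrier G" "b \<in> carrier G" and eq: "a [^] m = b [^] n"
  obtains c where "c \<in> carrier G" "a = c [^] (n div gcd m n)" "b = c [^] (m div gcd m n)"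
proof -
  define g where "g = gcd m n"
  define p where "p = m div g"
  define q where "q = n div g"
  have "0 < g" and m: "m = p * g" and n: "n = q * g"
    using \<open>0 < m\<close> by (simp_all add: g_def p_def q_def)
  have "(a [^] p \<otimes> inv (b [^] q)) [^] g = a [^] m \<otimes> inv (b [^] n)"
    using ab by (simp add: nat_pow_distrib nat_pow_inv nat_pow_pow m n)
  also have "\<dots> = \<one>"
    using ab eq by simp
  finally have "a [^] p \<otimes> inv (b [^] q) = \<one>"
    using ab torsion_free[OF _ \<open>0 < g\<close>] by auto
  then have pq: "a [^] int p = b [^] int q"
    using ab by (simp add: int_pow_int inv_solve_right')
  have "coprime (int p) (int q)"
    using \<open>0 < m\<close> by (simp add: p_def q_def g_def div_gcd_coprime)
  then obtain u v :: int where uv: "u * int p + v * int q = 1"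
    using bezout_int by (metis coprime_imp_gcd_eq_1)
  \<comment> \<open>If \<open>a = c [^] q\<close> and \<open>b = c [^] p\<close>, then
    \<open>c = c [^] (u * p + v * q)\<close> must be \<open>b [^] u \<otimes> a [^] v\<close>.
    Conversely, \<open>a [^] p = b [^] q\<close> shows that this element has the required
    powers.\<close>
  define c where "c = b [^] u \<otimes> a [^] v"
  have c: "c \<in> carrier G"
    using ab by (simp add: c_def)
  have "c [^] int q = (b [^] int q) [^] u \<otimes> a [^] (v * int q)"
    using ab by (simp add: c_def int_pow_distrib int_pow_pow mult.commute)
  also have "\<dots> = a [^] (u * int p + v * int q)"
    using ab by (simp flip: pq add: int_pow_pow int_pow_mult mult.commute)
  finally have "a = c [^] q"
    using ab by (simp add: uv int_pow_int)
  moreover have "c [^] int p = b [^] (u * int p) \<otimes> (a [^] int p) [^] v"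
    using ab by (simp add: c_def int_pow_distrib int_pow_pow mult.commute)
  then have "c [^] int p = b [^] (u * int p + v * int q)"
    using ab by (simp add: pq int_pow_pow int_pow_mult mult.commute)
  then have "b = c [^] p"
    using ab by (simp add: uv int_pow_int)
  ultimately show ?thesis
    using that c unfolding p_def q_def g_def by blast
qed

text \<open>Pigeonhole: the conjugates of \<open>n\<close> by the powers of \<open>x\<close> with
  exponents from 0 to \<open>card N\<close> all lie in \<open>N\<close>, so two of them agree. The
  difference \<open>k\<close> of the two exponents gives a power of \<open>x\<close> commuting with
  \<open>n\<close>, and \<open>k\<close> divides the factorial because it is at most
  \<open>card N\<close>.\<close>

lemma (in group) normal_imp_centralizing_exponent:
  assumes N: "N \<lhd> G" and "finite N" and x: "x \<in> carrier G" and n: "n \<in> N"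
  shows "x [^] (fact (card N) :: nat) \<otimes> n = n \<otimes> x [^] (fact (card N) :: nat)"
proof -
  interpret N: normal N G by (fact N)
  have nc: "n \<in> carrier G"
    using n by simp
  define f where "f k = x [^] k \<otimes> n \<otimes> inv (x [^] k)" for k :: nat
  have "f ` {..card N} \<subseteq> N"
    unfolding f_def using N.inv_op_closed2 n x by blast
  then have "card (f ` {..card N}) < card {..card N}"
    using card_mono[OF \<open>finite N\<close>] by (simp add: le_imp_less_Suc)
  then obtain i j where "i \<le> card N" "j \<le> card N" "i \<noteq> j" "f i = f j"
    by (meson pigeonhole inj_onI atMost_iff)
  then obtain i k where ik: "i + k \<le> card N" "0 < k" "f i = f (i + k)"
    by (metis less_imp_add_positive linorder_neqE_nat)
  have "x [^] i \<otimes> (n \<otimes> x [^] k) = f i \<otimes> x [^] (i + k)"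
    using nc x by (simp add: f_def inv_solve_right' m_assoc inv_solve_left flip: nat_pow_mult)
  also have "\<dots> = x [^] (i + k) \<otimes> n"
    unfolding ik(3) using nc x by (simp add: f_def m_assoc)
  also have "\<dots> = x [^] i \<otimes> (x [^] k \<otimes> n)"
    using nc x by (simp add: m_assoc flip: nat_pow_mult)
  finally have comm: "x [^] k \<otimes> n = n \<otimes> x [^] k"
    using nc x by simp
  have "k dvd fact (card N)"
    using ik by (intro dvd_fact) auto
  then obtain l where "fact (card N) = k * l" ..
  then show ?thesis
    using group_commutes_pow[OF comm, of l] nc x by (simp add: nat_pow_pow)
qed

lemma (in group) subgroup_nat_pow_closed:
  assumes "subgroup K G" and "x \<in> K"
  shows "x [^] (n::nat) \<in> K"
  using subgroup_int_pow_closed[OF assms, of "int n"] by (simp add: int_pow_int)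

text \<open>Here \<open>c\<close> is the commutator of \<open>u\<close> and \<open>s\<close>. Each
  factor \<open>u\<close> moved past \<open>s\<close> leaves one \<open>c\<close>, which can be
  collected on the left because \<open>u\<close> commutes with \<open>c\<close>.\<close>

lemma (in group) commutator_power:
  assumes us: "u \<in> carrier G" "s \<in> carrier G" "c \<in> carrier G"
    and uc: "u \<otimes> c = c \<otimes> u" and usc: "u \<otimes> s = c \<otimes> s \<otimes> u"
  shows "u [^] (j::nat) \<otimes> s = c [^] j \<otimes> s \<otimes> u [^] j"
proof (induction j)
  case 0
  then show ?case
    using us by simp
next
  case (Suc j)
  have "u [^] j \<otimes> c = c \<otimes> u [^] j"
    using us uc by (simp add: group_commutes_pow)
  then have "u [^] Suc j \<otimes> s = c \<otimes> (u [^] j \<otimes> s) \<otimes> u"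
    using us by (simp add: m_assoc usc flip: m_assoc[of _ c])
  also have "\<dots> = c [^] Suc j \<otimes> s \<otimes> u [^] Suc j"
    unfolding Suc nat_pow_Suc2[OF us(3)] using us by (simp add: m_assoc)
  finally show ?case .
qed

lemma (in group) pow_card_subgroup_eq_one:
  assumes "subgroup N G" and "x \<in> N"
  shows "x [^] card N = \<one>"
proof -
  interpret N: group "G\<lparr>carrier := N\<rparr>"
    using assms(1) by (rule subgroup_imp_group)
  show ?thesis
    using N.pow_order_eq_1[of x] assms(2) by (simp add: Coset.order_def flip: nat_pow_consistent)
qed

text \<open>The image is a subgroup because the power map is a homomorphism on \<open>K\<close>, and
  it is normal because conjugation commutes with taking powers. \<open>K\<close> itself may be
  non-abelian.\<close>

lemma (in group) normal_image_pow:
  assumes K: "K \<lhd> G"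
    and pow: "\<And>x y. x \<in> K \<Longrightarrow> y \<in> K \<Longrightarrow> (x \<otimes> y) [^] (m::nat) = x [^] m \<otimes> y [^] m"
  shows "(\<lambda>x. x [^] m) ` K \<lhd> G"
proof -
  interpret K: normal K G by (fact K)
  have cancel: "inv x \<otimes> (x \<otimes> y) = y" if "x \<in> carrier G" "y \<in> carrier G" for x y
    using that by (simp flip: m_assoc)
  have "x \<otimes> k [^] m \<otimes> inv x = (x \<otimes> k \<otimes> inv x) [^] m" if "x \<in> carrier G" "k \<in> K" for x k
  proof (induction m)
    case (Suc j)
    have "x \<otimes> k [^] Suc j \<otimes> inv x = (x \<otimes> k [^] j \<otimes> inv x) \<otimes> (x \<otimes> k \<otimes> inv x)"
      using that cancel by (simp add: m_assoc)
    then show ?case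
      by (simp add: Suc)
  qed (use that in simp)
  moreover have "subgroup ((\<lambda>x. x [^] m) ` K) G"
  proof (rule subgroupI)
    fix a b assume "a \<in> (\<lambda>x. x [^] m) ` K" "b \<in> (\<lambda>x. x [^] m) ` K"
    then obtain x y where xy: "x \<in> K" "y \<in> K" "a = x [^] m" "b = y [^] m"
      by blast
    show "inv a \<in> (\<lambda>x. x [^] m) ` K"
      using xy K.m_inv_closed by (intro image_eqI[of _ _ "inv x"]) (simp_all add: nat_pow_inv)
    show "a \<otimes> b \<in> (\<lambda>x. x [^] m) ` K"
      using xy by (intro image_eqI[of _ _ "x \<otimes> y"]) (simp_all add: pow)
  next
    show "(\<lambda>x. x [^] m) ` K \<noteq> {}"
      using K.one_closed by blast
  qed auto
  ultimately show ?thesis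
    unfolding normal_inv_iff using K.inv_op_closed2
    by (intro conjI ballI) (simp, blast)
qed

section \<open>Powers of a transversal over a torsion-free abelian normal subgroup\<close>

text \<open>Purely algebraic form of the setting: \<open>h\<close> plays the role of the projection
  from \<G> to \<S>, \<open>A\<close> that of the translation group of \<S>, and \<open>T\<close>
  picks one element from each coset of the kernel in the preimage of \<open>A\<close>.\<close>

locale finite_kernel_transversal = group_hom G H h for G (structure) and H (structure) and h +
  fixes A and T
  assumes finite_kernel: "finite (kernel G H h)"
    and normal_A: "A \<lhd> H"
    and comm_A: "comm_group (H\<lparr>carrier := A\<rparr>)"
    and torsion_free_A: "\<And>a n. a \<in> A \<Longrightarrow> 0 < n \<Longrightarrow> a [^]\<^bsub>H\<^esub> (n::nat) = \<one>\<^bsub>H\<^esub> \<Longrightarrow> a = \<one>\<^bsub>H\<^esub>"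
    and T_subset: "T \<subseteq> carrier G"
    and bij_T: "bij_betw h T A"
begin

definition powT :: "nat \<Rightarrow> 'a set"
  where "powT m = (\<lambda>t. t [^] m) ` T"

lemma T_carrier [simp]: "t \<in> T \<Longrightarrow> t \<in> carrier G"
  using T_subset by blast

lemma h_T [simp]: "t \<in> T \<Longrightarrow> h t \<in> A"
  using bij_T by (auto simp: bij_betw_def)

lemma lift_T:
  assumes "a \<in> A"
  obtains t where "t \<in> T" "h t = a"
  using assms bij_T by (auto simp: bij_betw_def)

lemma A_carrier [simp]: "a \<in> A \<Longrightarrow> a \<in> carrier H"
  using normal_imp_subgroup[OF normal_A] by (rule subgroup.mem_carrier)

lemma common_root_A:
  assumes "0 < m" "a \<in> A" "b \<in> A" "a [^]\<^bsub>H\<^esub> (m::nat) = b [^]\<^bsub>H\<^esub> (n::nat)"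
  obtains c where "c \<in> A" "a = c [^]\<^bsub>H\<^esub> (n div gcd m n)" "b = c [^]\<^bsub>H\<^esub> (m div gcd m n)"
proof -
  interpret AG: comm_group "H\<lparr>carrier := A\<rparr>"
    by (fact comm_A)
  obtain c where "c \<in> carrier (H\<lparr>carrier := A\<rparr>)"
    "a = c [^]\<^bsub>H\<lparr>carrier := A\<rparr>\<^esub> (n div gcd m n)" "b = c [^]\<^bsub>H\<lparr>carrier := A\<rparr>\<^esub> (m div gcd m n)"
  proof (rule AG.common_root_of_equal_powers[of m a b n])
    show "c = \<one>\<^bsub>H\<lparr>carrier := A\<rparr>\<^esub>"
      if "c \<in> carrier (H\<lparr>carrier := A\<rparr>)" "0 < k" "c [^]\<^bsub>H\<lparr>carrier := A\<rparr>\<^esub> k = \<one>\<^bsub>H\<lparr>carrier := A\<rparr>\<^esub>"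
      for c and k :: nat
      using that torsion_free_A[of c k] by (simp flip: H.nat_pow_consistent)
  qed (use assms in \<open>simp_all flip: H.nat_pow_consistent\<close>)
  then show ?thesis
    using that by (simp flip: H.nat_pow_consistent)
qed

text \<open>For equal exponents \<open>common_root_A\<close> expresses \<open>a\<close> and
  \<open>b\<close> as the same power of one element.\<close>

lemma pow_A_inj:
  assumes "0 < n" "a \<in> A" "b \<in> A" "a [^]\<^bsub>H\<^esub> (n::nat) = b [^]\<^bsub>H\<^esub> n"
  shows "a = b"
  using common_root_A[OF assms] assms(1) by (metis div_self gcd_idem_nat less_numeral_extra(3))

text \<open>Roots in \<open>A\<close> are unique by \<open>pow_A_inj\<close>, so the projections of
  the underlying elements of \<open>T\<close> agree, and \<open>h\<close> is injective on
  \<open>T\<close>.\<close>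

lemma powT_inj:
  assumes "0 < m" "x \<in> powT m" "y \<in> powT m" "h x = h y"
  shows "x = y"
proof -
  obtain s t where x: "s \<in> T" "x = s [^] m" and y: "t \<in> T" "y = t [^] m"
    using assms(2,3) by (auto simp: powT_def)
  then have "h s = h t"
    using assms(1,4) pow_A_inj[of m "h s" "h t"] by (simp add: hom_nat_pow)
  then show ?thesis
    using x y bij_T by (auto simp: bij_betw_def inj_on_def)
qed

lemma powT_memI: "t \<in> T \<Longrightarrow> t [^] m \<in> powT m"
  by (simp add: powT_def)

lemma h_powT: "x \<in> powT m \<Longrightarrow> h x \<in> A"
  using H.subgroup_nat_pow_closed[OF normal_imp_subgroup[OF normal_A]] by (auto simp: powT_def hom_nat_pow)

lemma A_commute: "a \<in> A \<Longrightarrow> b \<in> A \<Longrightarrow> a \<otimes>\<^bsub>H\<^esub> b = b \<otimes>\<^bsub>H\<^esub> a"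
  using comm_monoid.m_comm[OF comm_group.axioms(1)[OF comm_A], of a b] by simp

lemma powT_normal_mult:
  assumes "powT m \<lhd> G" "0 < m"
  shows "powT (m * n) \<lhd> G"
proof -
  interpret P: normal "powT m" G
    by (fact assms(1))
  \<comment> \<open>Both products lie in the subgroup \<open>powT m\<close> and have the same image
    in the abelian group \<open>A\<close>. Commutativity makes the \<open>n\<close>-th power map a
    homomorphism on \<open>powT m\<close>.\<close>
  have comm: "x \<otimes> y = y \<otimes> x" if "x \<in> powT m" "y \<in> powT m" for x y
    using that by (intro powT_inj[OF assms(2)]) (simp_all add: A_commute h_powT)
  have "powT (m * n) = (\<lambda>x. x [^] n) ` powT m"
    unfolding powT_def image_image by (rule image_cong) (simp_all add: G.nat_pow_pow)
  also have "\<dots> \<lhd> G"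
    using assms(1) by (rule G.normal_image_pow) (simp add: comm G.pow_mult_distrib)
  finally show ?thesis .
qed

text \<open>Both elements turn out to be the power of one \<open>u\<close> in \<open>T\<close> with
  exponent the least common multiple of \<open>m\<close> and \<open>n\<close>. This \<open>u\<close>
  lifts the common root \<open>c\<close> of \<open>h s\<close> and \<open>h t\<close>; the subgroup
  property keeps the powers of \<open>u [^] m\<close> and \<open>u [^] n\<close> inside sets on
  which \<open>h\<close> is injective.\<close>

lemma powT_agree:
  assumes m: "subgroup (powT m) G" "0 < m" and n: "subgroup (powT n) G" "0 < n"
    and x: "x \<in> powT m" and y: "y \<in> powT n" and eq: "h x = h y"
  shows "x = y"
proof -
  define g where "g = gcd m n"
  obtain s t where s: "s \<in> T" "x = s [^] m" and t: "t \<in> T" "y = t [^] n"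
    using x y by (auto simp: powT_def)
  obtain c where c: "c \<in> A" "h s = c [^]\<^bsub>H\<^esub> (n div g)" "h t = c [^]\<^bsub>H\<^esub> (m div g)"
    using common_root_A[of m "h s" "h t" n] s t eq m(2) by (auto simp: hom_nat_pow g_def)
  obtain u where u: "u \<in> T" "h u = c"
    using c(1) by (rule lift_T)
  have "x = (u [^] m) [^] (n div g)"
  proof (rule powT_inj[OF m(2) x])
    show "(u [^] m) [^] (n div g) \<in> powT m"
      using u by (simp add: G.subgroup_nat_pow_closed[OF m(1)] powT_memI)
    show "h x = h ((u [^] m) [^] (n div g))"
      using s u c by (simp add: hom_nat_pow H.nat_pow_pow mult.commute)
  qed
  moreover have "y = (u [^] n) [^] (m div g)"
  proof (rule powT_inj[OF n(2) y])
    show "(u [^] n) [^] (m div g) \<in> powT n"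
      using u by (simp add: G.subgroup_nat_pow_closed[OF n(1)] powT_memI)
    show "h y = h ((u [^] n) [^] (m div g))"
      using t u c by (simp add: hom_nat_pow H.nat_pow_pow mult.commute)
  qed
  moreover have "m * (n div g) = n * (m div g)"
    by (simp add: g_def div_mult_swap mult.commute)
  ultimately show ?thesis
    using u by (simp add: G.nat_pow_pow)
qed

lemma powT_normal_gcd:
  assumes m: "powT m \<lhd> G" "0 < m" and n: "powT n \<lhd> G" "0 < n"
  shows "powT (gcd m n) \<lhd> G"
proof -
  define g where "g = gcd m n"
  define P where "P = powT m <#> powT n"
  have P: "P \<lhd> G"
    unfolding P_def using m(1) n(1) by (rule G.normal_subgroup_set_mult_closed)
  interpret M: normal "powT m" G by (fact m(1))
  interpret N: normal "powT n" G by (fact n(1))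
  interpret P: normal P G by (fact P)
  \<comment> \<open>The quotient of \<open>x\<close> and \<open>y\<close> lies in \<open>P\<close>
    and in the kernel. Factored as \<open>a \<otimes> b\<close>, it gives
    \<open>h a = h (inv b)\<close>, so \<open>powT_agree\<close> forces
    \<open>a = inv b\<close>.\<close>
  have inj: "x = y" if xy: "x \<in> P" "y \<in> P" "h x = h y" for x y
  proof -
    obtain a b where ab: "a \<in> powT m" "b \<in> powT n" "x \<otimes> inv y = a \<otimes> b"
      using P.m_closed[OF xy(1) P.m_inv_closed[OF xy(2)]] by (auto simp: P_def set_mult_def)
    have "h (x \<otimes> inv y) = \<one>\<^bsub>H\<^esub>"
      using xy by simp
    then have "h a = h (inv b)"
      using ab by (simp add: H.inv_solve_right' flip: H.inv_equality)
    then have "a = inv b"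
      using ab by (intro powT_agree[OF M.subgroup_axioms m(2) N.subgroup_axioms n(2)]) auto
    then have "x \<otimes> inv y = \<one>"
      using ab by simp
    then show ?thesis
      using xy by (simp add: G.inv_solve_right')
  qed
  \<comment> \<open>Bezout's identity writes the \<open>g\<close>-th power as a product of integer
    powers of \<open>t [^] m\<close> and \<open>t [^] n\<close>.\<close>
  have sub: "t [^] g \<in> P" if t: "t \<in> T" for t
  proof -
    obtain u v :: int where uv: "u * int m + v * int n = int g"
      using bezout_int[of "int m" "int n"] by (auto simp: g_def)
    have "t [^] g = t [^] (u * int m + v * int n)"
      by (simp add: uv int_pow_int)
    also have "\<dots> = (t [^] m) [^] u \<otimes> (t [^] n) [^] v"
      using t by (simp add: G.int_pow_mult G.int_pow_pow mult.commute flip: int_pow_int)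
    also have "\<dots> \<in> P"
      using G.subgroup_int_pow_closed[OF M.subgroup_axioms powT_memI[OF t], of u]
        G.subgroup_int_pow_closed[OF N.subgroup_axioms powT_memI[OF t], of v]
      unfolding P_def set_mult_def by blast
    finally show ?thesis .
  qed
  have "powT g = P"
  proof (intro equalityI subsetI)
    fix x assume x: "x \<in> P"
    then obtain s t where st: "s \<in> T" "t \<in> T" "x = s [^] m \<otimes> t [^] n"
      by (auto simp: P_def set_mult_def powT_def)
    \<comment> \<open>Since \<open>A\<close> is abelian, \<open>a\<close> is a \<open>g\<close>-th
      root of \<open>h x\<close>. For its lift \<open>w\<close>, the elements \<open>w [^] g\<close>
      and \<open>x\<close> of \<open>P\<close> have the same projection and therefore
      coincide.\<close>
    define a where "a = h s [^]\<^bsub>H\<^esub> (m div g) \<otimes>\<^bsub>H\<^esub> h t [^]\<^bsub>H\<^esub> (n div g)"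
    have "a \<in> A"
      using st normal_imp_subgroup[OF normal_A]
      by (auto simp: a_def intro!: subgroup.m_closed H.subgroup_nat_pow_closed)
    then obtain w where w: "w \<in> T" "h w = a"
      by (rule lift_T)
    have "a [^]\<^bsub>H\<^esub> g = h s [^]\<^bsub>H\<^esub> m \<otimes>\<^bsub>H\<^esub> h t [^]\<^bsub>H\<^esub> n"
      unfolding a_def using st normal_imp_subgroup[OF normal_A]
      by (subst H.pow_mult_distrib)
        (auto simp: A_commute H.subgroup_nat_pow_closed H.nat_pow_pow g_def)
    then have "h (w [^] g) = h x"
      using w st by (simp add: hom_nat_pow)
    then have "x = w [^] g"
      using inj sub w x by simp
    then show "x \<in> powT g"
      using w by (simp add: powT_def)
  qed (auto simp: powT_def sub)
  then show ?thesis
    using P by (simp add: g_def)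
qed

lemma ex_powT_normal: "\<exists>m>0. powT m \<lhd> G"
proof -
  define N where "N = kernel G H h"
  define e where "e = card N"
  define k :: nat where "k = fact e"
  define K where "K = {x \<in> carrier G. h x \<in> A}"
  have N: "N \<lhd> G"
    unfolding N_def by (rule normal_kernel)
  note N_sub = normal_imp_subgroup[OF N]
  have "finite N"
    using finite_kernel by (simp add: N_def)
  then have "0 < e"
    unfolding e_def card_gt_0_iff using subgroup.one_closed[OF N_sub] by blast
  have pow_e: "x [^] e = \<one>" if "x \<in> N" for x
    using G.pow_card_subgroup_eq_one[OF N_sub that] by (simp add: e_def)
  have K: "K \<lhd> G"
    unfolding G.normal_inv_iff
  proof (intro conjI ballI)
    show "subgroup K G"
      using normal_imp_subgroup[OF normal_A]
      by (intro G.subgroupI) (auto simp: K_def subgroup.one_closed subgroup.m_closed subgroup.m_inv_closed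
          intro!: exI[of _ \<one>])
    show "x \<otimes> y \<otimes> inv x \<in> K" if "x \<in> carrier G" "y \<in> K" for x y
      using that normal.inv_op_closed2[OF normal_A] by (simp add: K_def)
  qed
  note pow_K = G.subgroup_nat_pow_closed[OF normal_imp_subgroup[OF K]]
  \<comment> \<open>The power \<open>u = x [^] k\<close> commutes with every element of
    \<open>N\<close>, in particular with its commutator \<open>c\<close> with \<open>s\<close>,
    which lies in \<open>N\<close> because \<open>A\<close> is abelian. Hence moving
    \<open>u [^] e\<close> past \<open>s\<close> costs only \<open>c [^] e\<close>, which is
    trivial.\<close>
  have central: "x [^] (k * e) \<otimes> s = s \<otimes> x [^] (k * e)" if "x \<in> K" "s \<in> K" for x s
  proof -
    define u where "u = x [^] k"
    define c where "c = u \<otimes> s \<otimes> inv u \<otimes> inv s"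
    have u: "u \<in> K"
      unfolding u_def using that(1) by (rule pow_K)
    then have u': "u \<in> carrier G" "h u \<in> A" and s: "s \<in> carrier G" "h s \<in> A"
      using that(2) unfolding K_def by blast+
    have "h c = \<one>\<^bsub>H\<^esub>"
      using u' s A_commute[of "h u" "h s"] by (simp add: c_def H.m_assoc)
    then have c: "c \<in> N"
      using u' s by (simp add: N_def kernel_def c_def)
    have "u [^] e \<otimes> s = c [^] e \<otimes> s \<otimes> u [^] e"
    proof (rule G.commutator_power)
      show "u \<otimes> c = c \<otimes> u"
        unfolding u_def k_def e_def using G.normal_imp_centralizing_exponent[OF N \<open>finite N\<close> _ c] that
        by (simp add: K_def)
      show "u \<otimes> s = c \<otimes> s \<otimes> u"
        using u' s by (simp add: c_def G.m_assoc)
    qed (use u' s in \<open>simp_all add: c_def\<close>)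
    then show ?thesis
      using that by (simp add: pow_e[OF c] u_def K_def G.nat_pow_pow)
  qed
  \<comment> \<open>The first \<open>e\<close> makes powers central in \<open>K\<close>; the second
    kills the error \<open>n\<close> in \<open>N\<close> by which the power map with exponent
    \<open>k * e\<close> fails to be multiplicative.\<close>
  define m where "m = k * e * e"
  have pow_m: "(x \<otimes> y) [^] m = x [^] m \<otimes> y [^] m" if xy: "x \<in> K" "y \<in> K" for x y
  proof -
    define z where "z = x [^] (k * e) \<otimes> y [^] (k * e)"
    define n where "n = (x \<otimes> y) [^] (k * e) \<otimes> inv z"
    have pows: "x [^] (k * e) \<in> K" "y [^] (k * e) \<in> K"
      using xy by (simp_all add: pow_K)
    then have z: "z \<in> K" "z \<in> carrier G"
      using subgroup.m_closed[OF normal_imp_subgroup[OF K]] by (simp_all add: z_def K_def)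
    have "h n = \<one>\<^bsub>H\<^esub>"
      using xy z A_commute by (simp add: n_def z_def K_def hom_nat_pow H.pow_mult_distrib)
    then have n: "n \<in> N"
      using xy z by (simp add: N_def kernel_def n_def K_def)
    then have "n \<in> K"
      using subgroup.one_closed[OF normal_imp_subgroup[OF normal_A]]
      by (auto simp: N_def K_def kernel_def)
    have nG: "n \<in> carrier G"
      using n by (rule subgroup.mem_carrier[OF N_sub])
    have "n \<otimes> z = z \<otimes> n"
    proof -
      have "n \<otimes> z = x [^] (k * e) \<otimes> (n \<otimes> y [^] (k * e))"
        using central[OF xy(1) \<open>n \<in> K\<close>] xy nG by (simp add: z_def K_def flip: G.m_assoc)
      also have "\<dots> = z \<otimes> n"
        using central[OF xy(2) \<open>n \<in> K\<close>] xy nG by (simp add: z_def K_def G.m_assoc)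
      finally show ?thesis .
    qed
    then have "(n \<otimes> z) [^] e = z [^] e"
      using n nG z by (simp add: G.pow_mult_distrib pow_e)
    moreover have "n \<otimes> z = (x \<otimes> y) [^] (k * e)"
      using xy z by (simp add: n_def K_def G.m_assoc)
    ultimately have "(x \<otimes> y) [^] m = z [^] e"
      using xy by (simp add: m_def K_def G.nat_pow_pow)
    also have "\<dots> = x [^] m \<otimes> y [^] m"
      using G.pow_mult_distrib[OF central[OF xy(1) pows(2)], of e] xy
      by (simp add: z_def m_def K_def G.nat_pow_pow)
    finally show ?thesis .
  qed
  \<comment> \<open>Every \<open>x\<close> in \<open>K\<close> differs from an element of
    \<open>T\<close> by a factor in \<open>N\<close>, and the \<open>m\<close>-th power map is
    multiplicative on \<open>K\<close> and trivial on \<open>N\<close>.\<close>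
  have "powT m = (\<lambda>x. x [^] m) ` K"
  proof (intro equalityI subsetI)
    fix y assume "y \<in> (\<lambda>x. x [^] m) ` K"
    then obtain x where x: "x \<in> K" "y = x [^] m"
      by blast
    obtain t where t: "t \<in> T" "h t = h x"
      using x lift_T[of "h x"] by (auto simp: K_def)
    define n where "n = inv t \<otimes> x"
    have n: "n \<in> N"
      using x t by (simp add: N_def K_def kernel_def n_def)
    then have "n [^] m = (n [^] e) [^] (k * e)"
      using subgroup.mem_carrier[OF N_sub n] by (simp add: m_def G.nat_pow_pow mult_ac)
    then have "n [^] m = \<one>"
      by (simp add: pow_e[OF n])
    moreover have "x = t \<otimes> n"
      using x t by (simp add: n_def K_def flip: G.m_assoc)
    moreover have "t \<in> K" "n \<in> K"
      using t n subgroup.one_closed[OF normal_imp_subgroup[OF normal_A]] h_T[OF t(1)]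
      by (auto simp: K_def N_def kernel_def)
    ultimately have "x [^] m = t [^] m"
      using pow_m[of t n] t(1) by simp
    then show "y \<in> powT m"
      using x(2) powT_memI[OF t(1)] by simp
  qed (auto simp: powT_def K_def)
  also have "\<dots> \<lhd> G"
    using K pow_m by (rule G.normal_image_pow)
  finally have "powT m \<lhd> G" .
  moreover have "0 < m"
    using \<open>0 < e\<close> by (simp add: m_def k_def)
  ultimately show ?thesis
    by blast
qed

theorem ex1_powT_normal_multiples:
  "\<exists>!m\<^sub>0. 1 \<le> m\<^sub>0 \<and> {m. 1 \<le> m \<and> powT m \<lhd> G} = {m\<^sub>0 * n | n. 1 \<le> n}"
proof (rule ex1_generator_of_multiples)
  show "{m. 1 \<le> m \<and> powT m \<lhd> G} \<noteq> {}"
    using ex_powT_normal by (auto simp: Suc_le_eq)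
qed (auto simp: Suc_le_eq intro: powT_normal_mult powT_normal_gcd)

end

section \<open>Block sums and translations in the Euclidean group\<close>

lemma mult_mat_zero_vec:
  fixes A :: "'a :: semiring_0 mat"
  assumes "A \<in> carrier_mat n m"
  shows "A *\<^sub>v 0\<^sub>v m = 0\<^sub>v n"
  using assms by (intro eq_vecI) auto

lemma euclidean_mult_fst: "fst (x \<otimes>\<^bsub>euclidean_group d\<^esub> y) = fst x * fst y"
  by (simp add: euclidean_group_def split: prod.split)

lemma euclidean_mult_translation:
  assumes "b \<in> carrier_vec d" "c \<in> carrier_vec d"
  shows "(1\<^sub>m d, b) \<otimes>\<^bsub>euclidean_group d\<^esub> (1\<^sub>m d, c) = (1\<^sub>m d, b + c)"
  using assms by (simp add: euclidean_group_def)

lemma iso_sum_mult: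
  assumes "A \<in> orth_group d\<^sub>1" "B \<in> orth_group d\<^sub>1"
    and "g \<in> carrier (euclidean_group d\<^sub>2)" "h \<in> carrier (euclidean_group d\<^sub>2)"
  shows "iso_sum A g \<otimes>\<^bsub>euclidean_group (d\<^sub>1 + d\<^sub>2)\<^esub> iso_sum B h
      = iso_sum (A * B) (g \<otimes>\<^bsub>euclidean_group d\<^sub>2\<^esub> h)"
proof -
  obtain C c D e where g: "g = (C, c)" and h: "h = (D, e)"
    by (cases g, cases h) blast
  have A: "A \<in> carrier_mat d\<^sub>1 d\<^sub>1" and B: "B \<in> carrier_mat d\<^sub>1 d\<^sub>1"
    and C: "C \<in> carrier_mat d\<^sub>2 d\<^sub>2" "c \<in> carrier_vec d\<^sub>2"
    and D: "D \<in> carrier_mat d\<^sub>2 d\<^sub>2" "e \<in> carrier_vec d\<^sub>2"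
    using assms g h by (auto simp: euclidean_group_def orth_group_def)
  have [simp]: "dim_row A = d\<^sub>1" "dim_col A = d\<^sub>1" "dim_row B = d\<^sub>1" "dim_col B = d\<^sub>1"
    "dim_row C = d\<^sub>2" "dim_col C = d\<^sub>2" "dim_row D = d\<^sub>2" "dim_col D = d\<^sub>2"
    using A B C D by auto
  have "four_block_mat A (0\<^sub>m d\<^sub>1 d\<^sub>2) (0\<^sub>m d\<^sub>2 d\<^sub>1) C * four_block_mat B (0\<^sub>m d\<^sub>1 d\<^sub>2) (0\<^sub>m d\<^sub>2 d\<^sub>1) D
      = four_block_mat (A * B) (0\<^sub>m d\<^sub>1 d\<^sub>2) (0\<^sub>m d\<^sub>2 d\<^sub>1) (C * D)"
    using A B C D
    by (simp add: mult_four_block_mat[of _ d\<^sub>1 d\<^sub>1 _ d\<^sub>2 _ d\<^sub>2 _ _ d\<^sub>1 _ d\<^sub>2])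
  moreover have "A *\<^sub>v 0\<^sub>v d\<^sub>1 = 0\<^sub>v d\<^sub>1"
    using A by (rule mult_mat_zero_vec)
  then have "four_block_mat A (0\<^sub>m d\<^sub>1 d\<^sub>2) (0\<^sub>m d\<^sub>2 d\<^sub>1) C *\<^sub>v (0\<^sub>v d\<^sub>1 @\<^sub>v e) = 0\<^sub>v d\<^sub>1 @\<^sub>v (C *\<^sub>v e)"
    using mult_mat_vec_split[OF A C(1) zero_carrier_vec D(2)] by simp
  moreover have "(0\<^sub>v d\<^sub>1 @\<^sub>v c) + (0\<^sub>v d\<^sub>1 @\<^sub>v (C *\<^sub>v e)) = 0\<^sub>v d\<^sub>1 @\<^sub>v (c + C *\<^sub>v e)"
    using C D by (simp add: append_vec_add[of _ d\<^sub>1 _ _ d\<^sub>2])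
  ultimately show ?thesis
    by (simp add: g h euclidean_group_def)
qed

lemma orth_group_mult_closed:
  assumes "A \<in> orth_group d" "B \<in> orth_group d"
  shows "A * B \<in> orth_group d"
  using monoid.m_closed[OF group.is_monoid[OF group_euclidean_group], of "(A, 0\<^sub>v d)" d "(B, 0\<^sub>v d)"] assms
  by (simp add: euclidean_group_def)

text \<open>Reading off a corner block is not multiplicative in general. On \<open>orth_sum\<close>
  the off-diagonal blocks vanish, and the projection inverts \<open>iso_sum\<close> in its second
  argument.\<close>

lemma iso_proj_mult:
  assumes "S \<subseteq> carrier (euclidean_group d\<^sub>2)"
    and "x \<in> orth_sum d\<^sub>1 S" "y \<in> orth_sum d\<^sub>1 S"
  shows "iso_proj d\<^sub>1 d\<^sub>2 (x \<otimes>\<^bsub>euclidean_group (d\<^sub>1 + d\<^sub>2)\<^esub> y)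
      = iso_proj d\<^sub>1 d\<^sub>2 x \<otimes>\<^bsub>euclidean_group d\<^sub>2\<^esub> iso_proj d\<^sub>1 d\<^sub>2 y"
proof -
  obtain A g B h where x: "x = iso_sum A g" "A \<in> orth_group d\<^sub>1" "g \<in> carrier (euclidean_group d\<^sub>2)"
    and y: "y = iso_sum B h" "B \<in> orth_group d\<^sub>1" "h \<in> carrier (euclidean_group d\<^sub>2)"
    using assms unfolding orth_sum_def by blast
  then show ?thesis
    by (simp add: iso_sum_mult iso_proj_iso_sum orth_group_mult_closed
        monoid.m_closed[OF group.is_monoid[OF group_euclidean_group]])
qed

text \<open>The translations form the kernel of the linear part \<open>fst\<close>, which is
  multiplicative; closure under inverses and conjugation follows from comparing linear
  parts.\<close>

lemma translations_of_normal:
  assumes S: "subgroup S (euclidean_group d)"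
  shows "translations_of d S \<lhd> (euclidean_group d)\<lparr>carrier := S\<rparr>"
proof -
  interpret S: group "(euclidean_group d)\<lparr>carrier := S\<rparr>"
    by (rule group.subgroup_imp_group[OF group_euclidean_group S])
  have tr: "translations_of d S = {x \<in> S. fst x = 1\<^sub>m d}"
    by (auto simp: translations_of_def)
  have one: "fst \<one>\<^bsub>(euclidean_group d)\<lparr>carrier := S\<rparr>\<^esub> = 1\<^sub>m d"
    by (simp add: euclidean_group_def)
  have mat: "fst x \<in> carrier_mat d d" if "x \<in> S" for x
    using subgroup.subset[OF S] that by (auto simp: euclidean_group_def orth_group_def)
  have mult: "fst (x \<otimes>\<^bsub>(euclidean_group d)\<lparr>carrier := S\<rparr>\<^esub> y) = fst x * fst y" for x y
    by (simp add: euclidean_mult_fst)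
  have inv: "fst x * fst (inv\<^bsub>(euclidean_group d)\<lparr>carrier := S\<rparr>\<^esub> x) = 1\<^sub>m d"
    and inv_S: "inv\<^bsub>(euclidean_group d)\<lparr>carrier := S\<rparr>\<^esub> x \<in> S"
    if "x \<in> S" for x
    using S.r_inv[of x] S.inv_closed[of x] that one by (simp_all flip: mult)
  show ?thesis
    unfolding S.normal_inv_iff
  proof (intro conjI ballI S.subgroupI)
    have "\<one>\<^bsub>(euclidean_group d)\<lparr>carrier := S\<rparr>\<^esub> \<in> translations_of d S"
      using S.one_closed one by (simp add: tr)
    then show "translations_of d S \<noteq> {}"
      by blast
    show "inv\<^bsub>(euclidean_group d)\<lparr>carrier := S\<rparr>\<^esub> x \<in> translations_of d S"
      if "x \<in> translations_of d S" for x
      using that inv[of x] inv_S[of x] mat[of "inv\<^bsub>(euclidean_group d)\<lparr>carrier := S\<rparr>\<^esub> x"]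
      by (simp add: tr)
    show "x \<otimes>\<^bsub>(euclidean_group d)\<lparr>carrier := S\<rparr>\<^esub> y \<in> translations_of d S"
      if "x \<in> translations_of d S" "y \<in> translations_of d S" for x y
      using that S.m_closed[of x y] mult[of x y] by (simp add: tr)
    show "x \<otimes>\<^bsub>(euclidean_group d)\<lparr>carrier := S\<rparr>\<^esub> y
        \<otimes>\<^bsub>(euclidean_group d)\<lparr>carrier := S\<rparr>\<^esub> inv\<^bsub>(euclidean_group d)\<lparr>carrier := S\<rparr>\<^esub> x
        \<in> translations_of d S"
      if "x \<in> carrier ((euclidean_group d)\<lparr>carrier := S\<rparr>)" "y \<in> translations_of d S" for x y
      using that S.m_closed[OF S.m_closed[of x y] S.inv_closed[of x]] inv[of x] mat[of x]
      by (simp add: tr euclidean_mult_fst)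
  qed (auto simp: tr)
qed

lemma translations_of_comm_group:
  assumes S: "subgroup S (euclidean_group d)"
  shows "comm_group ((euclidean_group d)\<lparr>carrier := translations_of d S\<rparr>)"
proof -
  have "subgroup (translations_of d S) (euclidean_group d)"
    by (rule group.incl_subgroup[OF group_euclidean_group S
        normal_imp_subgroup[OF translations_of_normal[OF S]]])
  then have "group ((euclidean_group d)\<lparr>carrier := translations_of d S\<rparr>)"
    by (rule group.subgroup_imp_group[OF group_euclidean_group])
  then show ?thesis
  proof (rule group.group_comm_groupI)
    fix x y
    assume "x \<in> carrier ((euclidean_group d)\<lparr>carrier := translations_of d S\<rparr>)"
      "y \<in> carrier ((euclidean_group d)\<lparr>carrier := translations_of d S\<rparr>)"
    then obtain b c where "x = (1\<^sub>m d, b)" "y = (1\<^sub>m d, c)" "b \<in> carrier_vec d" "c \<in> carrier_vec d"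
      using subgroup.subset[OF S] by (auto simp: translations_of_def euclidean_group_def)
    then show "x \<otimes>\<^bsub>(euclidean_group d)\<lparr>carrier := translations_of d S\<rparr>\<^esub> y
        = y \<otimes>\<^bsub>(euclidean_group d)\<lparr>carrier := translations_of d S\<rparr>\<^esub> x"
      by (simp add: euclidean_mult_translation comm_add_vec)
  qed
qed

lemma translation_pow:
  assumes "b \<in> carrier_vec d"
  shows "(1\<^sub>m d, b) [^]\<^bsub>euclidean_group d\<^esub> (n::nat) = (1\<^sub>m d, real n \<cdot>\<^sub>v b)"
proof (induction n)
  case 0
  then show ?case
    using assms by (auto simp: nat_pow_def euclidean_group_def intro!: eq_vecI)
next
  case (Suc n)
  then show ?case
    using assms
    by (simp add: group.is_monoid[OF group_euclidean_group, THEN monoid.nat_pow_Suc]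
        euclidean_mult_translation) (auto simp: algebra_simps intro!: eq_vecI)
qed

lemma translation_torsion_free:
  assumes "b \<in> carrier_vec d" "0 < n"
    and "(1\<^sub>m d, b) [^]\<^bsub>euclidean_group d\<^esub> (n::nat) = \<one>\<^bsub>euclidean_group d\<^esub>"
  shows "(1\<^sub>m d, b) = \<one>\<^bsub>euclidean_group d\<^esub>"
proof -
  have "real n \<cdot>\<^sub>v b = 0\<^sub>v d"
    using assms by (simp add: translation_pow, simp add: euclidean_group_def)
  then have "real n * b $ i = 0" if "i < d" for i
    using assms(1) that by (metis carrier_vecD index_smult_vec(1) index_zero_vec(1))
  then have "b = 0\<^sub>v d"
    using assms(1,2) by (intro eq_vecI) auto
  then show ?thesis
    by (simp add: euclidean_group_def)
qed

section \<open>Boundedness of the orthogonal group and finiteness of stabilizers\<close>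

text \<open>The columns of an orthogonal matrix are unit vectors.\<close>

lemma orth_group_entry_le_one:
  assumes A: "A \<in> orth_group d" and i: "i < d" and j: "j < d"
  shows "\<bar>A $$ (i, j)\<bar> \<le> 1"
proof -
  have c: "A \<in> carrier_mat d d" and eq: "transpose_mat A * A = 1\<^sub>m d"
    using A by (auto simp: orth_group_def)
  have "(\<Sum>k<d. (A $$ (k, j))\<^sup>2) = (transpose_mat A * A) $$ (j, j)"
    using c j by (simp add: scalar_prod_def power2_eq_square lessThan_atLeast0)
  also have "\<dots> = 1"
    using j by (simp add: eq)
  finally have "(A $$ (i, j))\<^sup>2 \<le> 1"
    using member_le_sum[of i "{..<d}" "\<lambda>k. (A $$ (k, j))\<^sup>2"] i by simp
  then show ?thesis
    by (simp add: abs_square_le_1)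
qed

text \<open>The difference is the corresponding entry of \<open>transpose_mat X * (Y - X)\<close>, a
  sum of \<open>d\<close> products whose first factors are at most 1 in absolute value.\<close>

lemma orth_group_transpose_mult_near_one:
  assumes X: "X \<in> orth_group d" and Y: "Y \<in> carrier_mat d d"
    and near: "\<And>i j. i < d \<Longrightarrow> j < d \<Longrightarrow> \<bar>Y $$ (i, j) - X $$ (i, j)\<bar> \<le> \<delta>"
    and ij: "i < d" "j < d"
  shows "\<bar>(transpose_mat X * Y) $$ (i, j) - 1\<^sub>m d $$ (i, j)\<bar> \<le> real d * \<delta>"
proof -
  have c: "X \<in> carrier_mat d d" and eq: "1\<^sub>m d = transpose_mat X * X"
    using X by (auto simp: orth_group_def)
  have "(transpose_mat X * Y) $$ (i, j) - 1\<^sub>m d $$ (i, j)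
      = (\<Sum>k<d. X $$ (k, i) * (Y $$ (k, j) - X $$ (k, j)))"
    unfolding eq using c Y ij
    by (simp add: scalar_prod_def lessThan_atLeast0 right_diff_distrib sum_subtractf)
  also have "\<bar>\<dots>\<bar> \<le> (\<Sum>k<d. \<bar>X $$ (k, i) * (Y $$ (k, j) - X $$ (k, j))\<bar>)"
    by (rule sum_abs)
  also have "\<dots> \<le> (\<Sum>k<d. 1 * \<delta>)"
    unfolding abs_mult using orth_group_entry_le_one[OF X _ ij(1)] near ij(2)
    by (intro sum_mono mult_mono) auto
  finally show ?thesis
    by simp
qed

text \<open>The orthogonal group is bounded, so the entries of its elements, rounded to a fine grid,
  take only finitely many values. Two elements with the same rounding have a quotient close
  to \<open>1\<close>, which equals \<open>1\<close> by discreteness.\<close>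

lemma finite_origin_stabilizer:
  assumes "discrete_subgroup d G"
  shows "finite {x \<in> G. snd x = 0\<^sub>v d}"
proof -
  interpret E: group "euclidean_group d"
    by (rule group_euclidean_group)
  have G: "subgroup G (euclidean_group d)" and disc: "discrete_in_euclidean_group d G"
    using assms by (auto simp: discrete_subgroup_def)
  have one: "(1\<^sub>m d, 0\<^sub>v d) = \<one>\<^bsub>euclidean_group d\<^esub>"
    by (simp add: euclidean_group_def)
  then have "(1\<^sub>m d, 0\<^sub>v d) \<in> G"
    using subgroup.one_closed[OF G] by simp
  then obtain \<epsilon> where "\<epsilon> > 0" and isolated: "\<And>A b. (A, b) \<in> G \<Longrightarrow>
      (\<And>i j. i < d \<Longrightarrow> j < d \<Longrightarrow> \<bar>A $$ (i, j) - 1\<^sub>m d $$ (i, j)\<bar> < \<epsilon>) \<Longrightarrow>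
      (\<And>i. i < d \<Longrightarrow> \<bar>b $ i - 0\<^sub>v d $ i\<bar> < \<epsilon>) \<Longrightarrow> (A, b) = (1\<^sub>m d, 0\<^sub>v d)"
    using disc unfolding discrete_in_euclidean_group_def by fast
  \<comment> \<open>The grid has width \<open>1 / K\<close>. By
    \<open>orth_group_transpose_mult_near_one\<close>, matrices with equal rounding have a quotient
    within \<open>d / K\<close> of the identity, which must be below \<epsilon>.\<close>
  obtain K :: nat where "real d / \<epsilon> < real K"
    using reals_Archimedean2 by blast
  moreover from this have "0 < K"
    using \<open>\<epsilon> > 0\<close> by (intro gr0I) (auto simp: field_simps)
  ultimately have K: "0 < K" "real d * (1 / real K) < \<epsilon>"
    using \<open>\<epsilon> > 0\<close> by (simp_all add: field_simps)
  define F where "F = {x \<in> G. snd x = 0\<^sub>v d}"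
  \<comment> \<open>Restricting to the index square makes the values extensional functions, so they
    lie in a finite function space.\<close>
  define f where "f x = (\<lambda>p\<in>{..<d} \<times> {..<d}. \<lfloor>real K * fst x $$ p\<rfloor>)" for x :: isometry
  have orth: "fst x \<in> orth_group d" if "x \<in> F" for x
    using subgroup.subset[OF G] that by (auto simp: F_def euclidean_group_def)
  have "f ` F \<subseteq> ({..<d} \<times> {..<d}) \<rightarrow>\<^sub>E {- int K..int K}"
  proof -
    have "\<lfloor>real K * fst x $$ (i, j)\<rfloor> \<in> {- int K..int K}" if "x \<in> F" "i < d" "j < d" for x i j
    proof -
      have "\<bar>real K * fst x $$ (i, j)\<bar> \<le> real K"
        using orth_group_entry_le_one[OF orth] that by (simp add: abs_mult mult_left_le)
      then show ?thesis
        by (auto simp: le_floor_iff floor_le_iff abs_le_iff)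
    qed
    then show ?thesis
      unfolding f_def by (intro image_subsetI) (auto simp: restrict_PiE_iff simp del: restrict_apply)
  qed
  then have "finite (f ` F)"
    by (rule finite_subset) (intro finite_PiE, auto)
  moreover have "inj_on f F"
  proof (rule inj_onI)
    fix x y assume xy: "x \<in> F" "y \<in> F" "f x = f y"
    obtain X where x: "x = (X, 0\<^sub>v d)" "x \<in> G" "X \<in> orth_group d" "X \<in> carrier_mat d d"
      using xy(1) orth[of x] by (cases x) (auto simp: F_def orth_group_def)
    obtain Y where y: "y = (Y, 0\<^sub>v d)" "y \<in> G" "Y \<in> carrier_mat d d"
      using xy(2) orth[of y] by (cases y) (auto simp: F_def orth_group_def)
    have near: "\<bar>Y $$ (i, j) - X $$ (i, j)\<bar> \<le> 1 / real K" if "i < d" "j < d" for i j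
    proof -
      have "\<lfloor>real K * Y $$ (i, j)\<rfloor> = \<lfloor>real K * X $$ (i, j)\<rfloor>"
        using fun_cong[OF xy(3), of "(i, j)"] that x(1) y(1) by (simp add: f_def)
      then have "\<bar>real K * Y $$ (i, j) - real K * X $$ (i, j)\<bar> \<le> 1"
        by linarith
      then have "real K * \<bar>Y $$ (i, j) - X $$ (i, j)\<bar> \<le> 1"
        by (simp add: abs_mult flip: right_diff_distrib)
      then show ?thesis
        using K(1) by (simp add: field_simps)
    qed
    have carr: "x \<in> carrier (euclidean_group d)" "y \<in> carrier (euclidean_group d)"
      using x y subgroup.subset[OF G] by auto
    have "transpose_mat X \<in> orth_group d" "transpose_mat X * X = 1\<^sub>m d"
      using x(3) mat_mult_left_right_inverse[of "transpose_mat X" d X] by (auto simp: orth_group_def)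
    then have "inv\<^bsub>euclidean_group d\<^esub> x = (transpose_mat X, 0\<^sub>v d)"
      using carr(1) x by (intro E.inv_equality) (auto simp: euclidean_group_def)
    then have quot: "inv\<^bsub>euclidean_group d\<^esub> x \<otimes>\<^bsub>euclidean_group d\<^esub> y = (transpose_mat X * Y, 0\<^sub>v d)"
      using x(4) y mult_mat_zero_vec[of "transpose_mat X" d d] by (simp add: euclidean_group_def)
    moreover have "inv\<^bsub>euclidean_group d\<^esub> x \<otimes>\<^bsub>euclidean_group d\<^esub> y \<in> G"
      using G x y by (intro subgroup.m_closed subgroup.m_inv_closed)
    ultimately have "(transpose_mat X * Y, 0\<^sub>v d) \<in> G"
      by simp
    then have "(transpose_mat X * Y, 0\<^sub>v d :: real vec) = (1\<^sub>m d, 0\<^sub>v d)"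
    proof (rule isolated)
      fix i j assume "i < d" "j < d"
      then show "\<bar>(transpose_mat X * Y) $$ (i, j) - 1\<^sub>m d $$ (i, j)\<bar> < \<epsilon>"
        using orth_group_transpose_mult_near_one[OF x(3) y(3) near] K(2) by (meson le_less_trans)
    qed (simp add: \<open>\<epsilon> > 0\<close>)
    then have "inv\<^bsub>euclidean_group d\<^esub> x \<otimes>\<^bsub>euclidean_group d\<^esub> y = \<one>\<^bsub>euclidean_group d\<^esub>"
      using quot one by simp
    then have "inv\<^bsub>euclidean_group d\<^esub> y = inv\<^bsub>euclidean_group d\<^esub> x"
      using carr by (intro E.inv_equality) auto
    then show "x = y"
      using carr by (metis E.inv_inv)
  qed
  ultimately show ?thesis
    unfolding F_def by (rule finite_imageD)
qed

section \<open>Application to the projection onto the space group\<close>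

theorem theorem3p11:
  fixes d d\<^sub>1 d\<^sub>2 :: nat
    and \<S> \<G> \<T> :: "isometry set"
    and M\<^sub>0 :: "nat set"
  assumes "1 \<le> d" and "d = d\<^sub>1 + d\<^sub>2"
    and "space_group d\<^sub>2 \<S>"
    and "discrete_subgroup d \<G>"
    and "\<G> \<subseteq> orth_sum d\<^sub>1 \<S>"
    and "iso_proj d\<^sub>1 d\<^sub>2 ` \<G> = \<S>"
    and "\<T> \<subseteq> \<G>"
    and "bij_betw (iso_proj d\<^sub>1 d\<^sub>2) \<T> (translations_of d\<^sub>2 \<S>)"
  defines "M\<^sub>0 \<equiv> {m. 1 \<le> m \<and>
      powers_of (euclidean_group d) \<T> (int m) \<lhd> (euclidean_group d)\<lparr>carrier := \<G>\<rparr>}"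
  shows "\<exists>!m\<^sub>0. 1 \<le> m\<^sub>0 \<and> M\<^sub>0 = {m\<^sub>0 * n | n. 1 \<le> n}"
proof -
  note d = assms(2) and T = assms(7,8)
  have S: "subgroup \<S> (euclidean_group d\<^sub>2)" and G: "subgroup \<G> (euclidean_group d)"
    using assms(3,4) by (auto simp: space_group_def discrete_subgroup_def)
  have S_sub: "\<S> \<subseteq> carrier (euclidean_group d\<^sub>2)"
    by (rule subgroup.subset[OF S])
  interpret E: group "euclidean_group d"
    by (rule group_euclidean_group)
  let ?G = "(euclidean_group d)\<lparr>carrier := \<G>\<rparr>"
  let ?S = "(euclidean_group d\<^sub>2)\<lparr>carrier := \<S>\<rparr>"
  have group_G: "group ?G" and group_S: "group ?S"
    using group.subgroup_imp_group[OF group_euclidean_group] G S by blast+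
  have hom: "iso_proj d\<^sub>1 d\<^sub>2 \<in> hom ?G ?S"
    using assms(5,6) iso_proj_mult[OF S_sub] by (auto simp: hom_def d subset_iff)
  \<comment> \<open>An element of the kernel is the sum of an orthogonal matrix and the identity, so
    it fixes the origin; finiteness then follows from
    \<open>finite_origin_stabilizer\<close>.\<close>
  have "kernel ?G ?S (iso_proj d\<^sub>1 d\<^sub>2) \<subseteq> {x \<in> \<G>. snd x = 0\<^sub>v d}"
  proof
    fix x assume "x \<in> kernel ?G ?S (iso_proj d\<^sub>1 d\<^sub>2)"
    then have x: "x \<in> \<G>" "iso_proj d\<^sub>1 d\<^sub>2 x = \<one>\<^bsub>euclidean_group d\<^sub>2\<^esub>"
      by (auto simp: kernel_def)
    then obtain A g where Ag: "x = iso_sum A g" "A \<in> orth_group d\<^sub>1" "g \<in> carrier (euclidean_group d\<^sub>2)"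
      using assms(5) S_sub unfolding orth_sum_def by blast
    then have "g = (1\<^sub>m d\<^sub>2, 0\<^sub>v d\<^sub>2)"
      using x(2) by (simp add: iso_proj_iso_sum) (simp add: euclidean_group_def)
    moreover have "0\<^sub>v d\<^sub>1 @\<^sub>v 0\<^sub>v d\<^sub>2 = 0\<^sub>v d"
      by (intro eq_vecI) (auto simp: d)
    ultimately show "x \<in> {x \<in> \<G>. snd x = 0\<^sub>v d}"
      using x(1) Ag(1,2) by (auto simp: orth_group_def)
  qed
  then have finite_ker: "finite (kernel ?G ?S (iso_proj d\<^sub>1 d\<^sub>2))"
    using finite_origin_stabilizer[OF assms(4)] by (rule finite_subset)
  have torsion: "a = \<one>\<^bsub>?S\<^esub>"
    if a: "a \<in> translations_of d\<^sub>2 \<S>" "0 < n" "a [^]\<^bsub>?S\<^esub> n = \<one>\<^bsub>?S\<^esub>" for a and n :: nat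
  proof -
    obtain b where b: "a = (1\<^sub>m d\<^sub>2, b)" "b \<in> carrier_vec d\<^sub>2"
      using a(1) S_sub by (auto simp: translations_of_def euclidean_group_def)
    have "a [^]\<^bsub>euclidean_group d\<^sub>2\<^esub> n = \<one>\<^bsub>euclidean_group d\<^sub>2\<^esub>"
      using a(3) monoid.nat_pow_consistent[OF group.is_monoid[OF group_euclidean_group]] by simp
    then show ?thesis
      using translation_torsion_free[OF b(2) a(2)] b(1) by simp
  qed
  interpret finite_kernel_transversal ?G ?S "iso_proj d\<^sub>1 d\<^sub>2" "translations_of d\<^sub>2 \<S>" \<T>
    using group_G group_S hom finite_ker translations_of_normal[OF S] translations_of_comm_group[OF S]
      torsion T
    by (intro finite_kernel_transversal.intro group_hom.intro group_hom_axioms.intro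
        finite_kernel_transversal_axioms.intro) simp_all
  \<comment> \<open>Integer powers in the ambient group agree with natural powers in the subgroup
    \<G>, in which \<open>powT\<close> is formed.\<close>
  have "powers_of (euclidean_group d) \<T> (int m) = powT m" for m
    unfolding powers_of_def powT_def by (auto simp: int_pow_int simp flip: E.nat_pow_consistent)
  then have "M\<^sub>0 = {m. 1 \<le> m \<and> powT m \<lhd> ?G}"
    by (simp add: M\<^sub>0_def)
  then show ?thesis
    using ex1_powT_normal_multiples by simp
qed

end
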